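(* Let $1<\alpha<2$, let $a,b\in\mathbb{R}$ be such that $b-a$ is an integer with $b-a\ge 2$, and let $q:\mathbb{N}^{b}_{a+2}\to\mathbb{R}$ satisfy $$\sum_{s=a+2}^{b}|q(s)|<\frac{\alpha-1}{b-a-1}.$$ Then the discrete fractional boundary value problem $$\begin{cases}(\nabla^{\alpha}_{a}u)(t)+q(t)u(t)=0,\quad t\in\mathbb{N}^{b}_{a+2},\\ (\nabla^{\alpha-1}_{a}u)(a+1)=0,\quad u(b)=0,\end{cases}$$ has no nontrivial solution on $\mathbb{N}^{b}_{a+1}$, i.e. its only solution $u:\mathbb{N}^{b}_{a+1}\to\mathbb{R}$ is $u\equiv0$.
   Context: For $a,b\in\mathbb{R}$ with $b-a\in\mathbb{Z}$: $\mathbb{N}_a=\{a,a+1,a+2,\dots\}$ and $\mathbb{N}_a^b=\{a,a+1,\dots,b\}$ (empty if $b<a$). Empty sums are $0$. The generalized rising function is $t^{\overline{r}}=\Gamma(t+r)/\Gamma(t)$ for $t,t+r\in\mathbb{R}\setminus\{0,-1,-2,\dots\}$, and $0^{\overline r}:=0$. The nabla difference is $(\nabla u)(t)=u(t)-u(t-1)$, and $\nabla^N$ is its $N$-fold iterate. For $\nu>0$ the nabla fractional sum based at $a$ is $(\nabla_a^{-\nu}u)(t)=\frac{1}{\Gamma(\nu)}\sum_{s=a+1}^{t}(t-s+1)^{\overline{\nu-1}}u(s)$ (so $(\nabla_a^{-\nu}u)(a)=0$ as an empty sum), and $\nabla_a^{-0}u=u$. For $\nu>0$ and a positive integer $N$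 with $N-1<\nu\le N$, the Riemann-Liouville nabla fractional difference is $(\nabla_a^{\nu}u)(t)=\big(\nabla^N(\nabla_a^{-(N-\nu)}u)\big)(t)$, $t\in\mathbb{N}_{a+N}$. These values at $t$ depend only on $u(a+1),\dots,u(t)$, so they make sense for $u$ defined on $\mathbb{N}_{a+1}^b$ and $t\le b$. *)

theory Defs
  imports "HOL-Analysis.Analysis"
begin

text \<open>
  Functions on discrete sets are represented by total functions on the reals, of which only the
  values on the relevant grid matter.
\<close>

definition grid :: "real \<Rightarrow> real \<Rightarrow> real set" where
  "grid a b = {t. t - a \<in> \<int> \<and> a \<le> t \<and> t \<le> b}"

text \<open>
  The quotient is the mathematical one when neither \<^term>\<open>t\<close> nor \<^term>\<open>t + r\<close>
  is a pole of \<^const>\<open>Gamma\<close>; at other nonzero arguments the value is a library convention.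
\<close>

definition rising :: "real \<Rightarrow> real \<Rightarrow> real" where
  "rising t r = (if t = 0 then 0 else Gamma (t + r) / Gamma t)"

definition nabla :: "(real \<Rightarrow> real) \<Rightarrow> real \<Rightarrow> real" where
  "nabla u t = u t - u (t - 1)"

text \<open>\<^term>\<open>nabla_frac_sum a \<nu>\<close> is the operator of order \<open>-\<nu>\<close>, meaningful for \<open>\<nu> \<ge> 0\<close>.\<close>

definition nabla_frac_sum :: "real \<Rightarrow> real \<Rightarrow> (real \<Rightarrow> real) \<Rightarrow> real \<Rightarrow> real" where
  "nabla_frac_sum a \<nu> u t =
     (if \<nu> = 0 then u t
      else 1 / Gamma \<nu> * (\<Sum>s\<in>grid (a + 1) t. rising (t - s + 1) (\<nu> - 1) * u s))"

text \<open>
  The Riemann--Liouville difference, meaningful for \<open>\<nu> > 0\<close>: the ceiling of \<open>\<nu>\<close> is the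
  unique positive integer \<open>N\<close> with \<open>N - 1 < \<nu> \<le> N\<close>.
\<close>

definition nabla_frac_diff :: "real \<Rightarrow> real \<Rightarrow> (real \<Rightarrow> real) \<Rightarrow> real \<Rightarrow> real" where
  "nabla_frac_diff a \<nu> u =
     (let N = nat \<lceil>\<nu>\<rceil> in (nabla ^^ N) (nabla_frac_sum a (real N - \<nu>) u))"

definition bvp_solution ::
    "real \<Rightarrow> real \<Rightarrow> real \<Rightarrow> (real \<Rightarrow> real) \<Rightarrow> (real \<Rightarrow> real) \<Rightarrow> bool" where
  "bvp_solution \<alpha> a b q u \<longleftrightarrow>
     (\<forall>t\<in>grid (a + 2) b. nabla_frac_diff a \<alpha> u t + q t * u t = 0) \<and>
     nabla_frac_diff a (\<alpha> - 1) u (a + 1) = 0 \<and>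
     u b = 0"

end

theory Submission
  imports Defs
begin

text \<open>
  The left boundary condition reads \<open>u(a + 1) = 0\<close>. If \<open>u\<close> vanishes at all grid points
  before \<open>t\<close>, then \<open>(\<nabla>\<^sub>a\<^sup>\<alpha> u)(t) = u(t)\<close>, because the kernel of the fractional sum is \<open>1\<close> on the diagonal;
  the equation at \<open>t\<close> becomes \<open>(1 + q(t)) u(t) = 0\<close>. The bound on \<open>q\<close> forces \<open>\<bar>q(t)\<bar> < 1\<close>,
  so \<open>u\<close> vanishes by induction along the grid.
\<close>

lemma finite_grid: "finite (grid a b)"
proof (rule finite_subset)
  show "grid a b \<subseteq> (\<lambda>i. a + of_int i) ` {0..\<lfloor>b - a\<rfloor>}"
  proof
    fix t assume "t \<in> grid a b"
    then obtain i where "t - a = of_int i" "a \<le> t" "t \<le> b"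
      unfolding grid_def by (auto elim: Ints_cases)
    then show "t \<in> (\<lambda>i. a + of_int i) ` {0..\<lfloor>b - a\<rfloor>}"
      by (intro image_eqI[where x = i]) (auto simp: le_floor_iff)
  qed
qed simp

lemma grid_conv_nat: "t \<in> grid a b \<longleftrightarrow> (\<exists>n::nat. t = a + real n \<and> t \<le> b)"
proof
  assume "t \<in> grid a b"
  then obtain i where i: "t - a = of_int i" "a \<le> t" "t \<le> b"
    unfolding grid_def by (auto elim: Ints_cases)
  then have "t = a + real (nat i)" by simp
  with i(3) show "\<exists>n::nat. t = a + real n \<and> t \<le> b" by blast
qed (auto simp: grid_def)

text \<open>This includes points \<open>t\<close> below \<open>a + 1\<close>, where the sum is
  empty. For \<open>\<nu> = 0\<close> the definition would return \<open>u t\<close>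
  instead.\<close>

lemma nabla_frac_sum_eq_zero:
  assumes "\<nu> > 0" and "\<And>s. s \<in> grid (a + 1) t \<Longrightarrow> u s = 0"
  shows "nabla_frac_sum a \<nu> u t = 0"
  using assms by (simp add: nabla_frac_sum_def)

text \<open>Only the term \<open>s = t\<close> survives. Its kernel is
  \<open>rising 1 (\<nu> - 1)\<close>, that is Gamma(\<nu>) / Gamma(1), which cancels the prefactor.
  The condition \<open>t \<in> grid (a + 1) t\<close> encodes that \<open>t\<close> is
  \<open>a + 1\<close> plus a natural number.\<close>

lemma nabla_frac_sum_eq_last:
  assumes "\<nu> > 0" and "t \<in> grid (a + 1) t"
    and "\<And>s. s \<in> grid (a + 1) t \<Longrightarrow> s < t \<Longrightarrow> u s = 0"
  shows "nabla_frac_sum a \<nu> u t = u t"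
proof -
  let ?f = "\<lambda>s. rising (t - s + 1) (\<nu> - 1) * u s"
  have "?f s = 0" if "s \<in> grid (a + 1) t - {t}" for s
    using that assms(3)[of s] by (force simp: grid_def)
  then have "(\<Sum>s\<in>grid (a + 1) t - {t}. ?f s) = 0"
    by (intro sum.neutral) blast
  then have "(\<Sum>s\<in>grid (a + 1) t. ?f s) = ?f t"
    by (simp add: sum.remove[OF finite_grid assms(2)])
  moreover have "Gamma \<nu> \<noteq> 0" using Gamma_real_pos[OF assms(1)] by simp
  ultimately show ?thesis using assms(1)
    by (simp add: nabla_frac_sum_def rising_def)
qed

lemma nabla_frac_diff_order_between_1_2:
  assumes "1 < \<alpha>" and "\<alpha> < 2"
  shows "nabla_frac_diff a \<alpha> u t =
    nabla_frac_sum a (2 - \<alpha>) u t - 2 * nabla_frac_sum a (2 - \<alpha>) u (t - 1)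
      + nabla_frac_sum a (2 - \<alpha>) u (t - 2)"
proof -
  have "nat \<lceil>\<alpha>\<rceil> = 2" using assms by linarith
  then show ?thesis
    by (simp add: nabla_frac_diff_def nabla_def numeral_2_eq_2 algebra_simps)
qed

lemma nabla_frac_diff_order_between_0_1:
  assumes "0 < \<alpha>" and "\<alpha> < 1"
  shows "nabla_frac_diff a \<alpha> u t =
    nabla_frac_sum a (1 - \<alpha>) u t - nabla_frac_sum a (1 - \<alpha>) u (t - 1)"
proof -
  have "nat \<lceil>\<alpha>\<rceil> = 1" using assms by linarith
  then show ?thesis by (simp add: nabla_frac_diff_def nabla_def)
qed

text \<open>The sum at \<open>a + 1\<close> has a single term and the one at \<open>a\<close> is
  empty. With order \<open>\<alpha> - 1\<close> this evaluates the left boundary condition.\<close>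

lemma nabla_frac_diff_initial:
  assumes "0 < \<alpha>" and "\<alpha> < 1"
  shows "nabla_frac_diff a \<alpha> u (a + 1) = u (a + 1)"
proof -
  have "nabla_frac_sum a (1 - \<alpha>) u (a + 1) = u (a + 1)"
    using assms by (intro nabla_frac_sum_eq_last) (auto simp: grid_def)
  moreover have "nabla_frac_sum a (1 - \<alpha>) u a = 0"
    using assms by (intro nabla_frac_sum_eq_zero) (auto simp: grid_def)
  ultimately show ?thesis
    using assms by (simp add: nabla_frac_diff_order_between_0_1)
qed

lemma nabla_frac_diff_eq_last:
  assumes "1 < \<alpha>" and "\<alpha> < 2" and "t \<in> grid (a + 1) t"
    and "\<And>s. s \<in> grid (a + 1) t \<Longrightarrow> s < t \<Longrightarrow> u s = 0"
  shows "nabla_frac_diff a \<alpha> u t = u t"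
proof -
  \<comment> \<open>Used for \<open>d = 1\<close> and \<open>d = 2\<close>: these sums see only
    points before \<open>t\<close>.\<close>
  have "nabla_frac_sum a (2 - \<alpha>) u (t - d) = 0" if "d > 0" for d
    using assms that by (intro nabla_frac_sum_eq_zero) (auto simp: grid_def)
  moreover have "nabla_frac_sum a (2 - \<alpha>) u t = u t"
    using assms by (intro nabla_frac_sum_eq_last) auto
  ultimately show ?thesis
    using assms by (simp add: nabla_frac_diff_order_between_1_2)
qed

lemma initial_value_problem_trivial:
  assumes "1 < \<alpha>" and "\<alpha> < 2"
    and q: "\<And>t. t \<in> grid (a + 2) b \<Longrightarrow> \<bar>q t\<bar> < 1"
    and eq: "\<And>t. t \<in> grid (a + 2) b \<Longrightarrow> nabla_frac_diff a \<alpha> u t + q t * u t = 0"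
    and init: "nabla_frac_diff a (\<alpha> - 1) u (a + 1) = 0"
    and t: "t \<in> grid (a + 1) b"
  shows "u t = 0"
proof -
  have "u (a + 1 + real n) = 0" if "a + 1 + real n \<le> b" for n
    using that
  \<comment> \<open>Strong induction, since the fractional difference at a point involves all
    earlier values and not just the last two.\<close>
  proof (induction n rule: less_induct)
    case (less n)
    let ?t = "a + 1 + real n"
    show ?case
    proof (cases n)
      \<comment> \<open>The equation starts only at \<open>a + 2\<close>, so the value at
        \<open>a + 1\<close> comes from the boundary condition.\<close>
      case 0
      then show ?thesis
        using init assms(1,2) by (simp add: nabla_frac_diff_initial)
    next
      case (Suc m)
      have "?t \<in> grid (a + 2) b"
        using less.prems Suc by (auto simp: grid_conv_nat)
      moreover have "nabla_frac_diff a \<alpha> u ?t = u ?t"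
      proof (rule nabla_frac_diff_eq_last[OF assms(1,2)])
        show "?t \<in> grid (a + 1) ?t" by (auto simp: grid_conv_nat)
        fix s assume "s \<in> grid (a + 1) ?t" "s < ?t"
        then obtain k where "s = a + 1 + real k" "k < n"
          by (auto simp: grid_conv_nat)
        with less show "u s = 0" by simp
      qed
      ultimately have "(1 + q ?t) * u ?t = 0" "\<bar>q ?t\<bar> < 1"
        using eq[of ?t] q[of ?t] by (simp_all add: distrib_right)
      then show ?thesis by auto
    qed
  qed
  with t show ?thesis by (auto simp: grid_conv_nat)
qed

theorem theorem3p6:
  fixes \<alpha> a b :: real and q :: "real \<Rightarrow> real"
  assumes "1 < \<alpha>" and "\<alpha> < 2"
    and "b - a \<in> \<int>" and "b - a \<ge> 2"
    and "(\<Sum>s\<in>grid (a + 2) b. \<bar>q s\<bar>) < (\<alpha> - 1) / (b - a - 1)"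
  shows "\<forall>u :: real \<Rightarrow> real. bvp_solution \<alpha> a b q u \<longleftrightarrow> (\<forall>t\<in>grid (a + 1) b. u t = 0)"
proof (intro allI iffI)
  fix u :: "real \<Rightarrow> real"
  assume "bvp_solution \<alpha> a b q u"
  moreover have "\<bar>q t\<bar> < 1" if "t \<in> grid (a + 2) b" for t
  proof -
    have "\<bar>q t\<bar> \<le> (\<Sum>s\<in>grid (a + 2) b. \<bar>q s\<bar>)"
      using that by (intro member_le_sum finite_grid) auto
    also note assms(5)
    \<comment> \<open>The numerator is below 1 and the denominator is at least 1.\<close>
    also have "(\<alpha> - 1) / (b - a - 1) \<le> 1"
      using assms(2,4) by simp
    finally show ?thesis .
  qed
  ultimately show "\<forall>t\<in>grid (a + 1) b. u t = 0"
    using initial_value_problem_trivial[OF assms(1,2)] unfolding bvp_solution_def by blast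
next
  \<comment> \<open>Here \<open>u\<close> may be nonzero off the grid, so each condition has to be
    reduced to values of \<open>u\<close> on the grid.\<close>
  fix u :: "real \<Rightarrow> real"
  assume u: "\<forall>t\<in>grid (a + 1) b. u t = 0"
  have shift: "t \<in> grid (a + 1) t" if "t \<in> grid (a + 2) b" for t
  proof -
    from that obtain n where "t = a + 1 + real (Suc n)"
      by (auto simp: grid_conv_nat)
    then show ?thesis unfolding grid_conv_nat by blast
  qed
  have "nabla_frac_diff a \<alpha> u t + q t * u t = 0" if t: "t \<in> grid (a + 2) b" for t
  proof -
    have "s \<in> grid (a + 1) b" if "s \<in> grid (a + 1) t" for s
      using that t by (auto simp: grid_def)
    then have "u s = 0" if "s \<in> grid (a + 1) t" for s
      using that u by blast
    then show ?thesis
      using nabla_frac_diff_eq_last[OF assms(1,2) shift[OF t], of u] shift[OF t] by simp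
  qed
  moreover have "a + 1 \<in> grid (a + 1) b"
    using assms(4) by (simp add: grid_def)
  \<comment> \<open>The integrality of \<open>b - a\<close> puts \<open>b\<close> itself on the
    grid, which gives the right boundary condition.\<close>
  moreover have "b \<in> grid (a + 1) b"
    using assms(3,4) Ints_diff[of "b - a" 1] by (simp add: grid_def diff_diff_eq)
  ultimately show "bvp_solution \<alpha> a b q u"
    using u assms(1,2) by (simp add: bvp_solution_def nabla_frac_diff_initial)
qed

end
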